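(* There is an absolute constant $c>0$ such that the following holds. Let $r_N$ be a sequence of real numbers such that $$r_N\to\infty\qquad\text{and}\qquad\frac{r_N}{N}\to0\qquad(N\to\infty).$$ Then, for all sufficiently large $N$, $$|\mathcal A_N(r_N)|\geq2^{c r_N^2\log(N/r_N)}.$$
   Context: All logarithms are natural. For integers $N\geq2$ and real $r>0$, $\mathcal A_N(r)$ denotes the set of adjacency matrices ($N\times N$ matrices with entries in $\{0,1\}$, symmetric, zero diagonal, indexed by $\mathbb Z_N=\mathbb Z/N\mathbb Z$) of labeled simple graphs on the vertex set $\mathbb Z_N$ with at least one edge and Fourier ratio at most $r$. The Fourier ratio of a nonzero $N\times N$ matrix $A$ is $\operatorname{FR}(A)=\|FAF\|_1/\|FAF\|_2$, where $F$ is the unitary Fourier matrix $F_{mx}=\frac1{\sqrt N}e^{-2\pi i mx/N}$, $\|\cdot\|_1$ is the entrywise $\ell^1$-norm and $\|\cdot\|_2$ is the Frobenius norm. *)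

theory Defs
  imports Complex_Main "Jordan_Normal_Form.Matrix"
begin

text \<open>
  Matrices indexed by the integers modulo \<open>N\<close> are \<open>N \<times> N\<close> matrices whose indices are the
  representatives \<open>0, \<dots>, N - 1\<close>; the entries of the Fourier matrix depend only on the
  residue classes of its indices.
\<close>

definition fourier_mat :: "nat \<Rightarrow> complex mat" where
  "fourier_mat N = mat N N (\<lambda>(m, x).
     1 / complex_of_real (sqrt (real N)) *
     exp (- 2 * complex_of_real pi * \<i> * of_nat m * of_nat x / of_nat N))"

definition entrywise_l1_norm :: "complex mat \<Rightarrow> real" where
  "entrywise_l1_norm A = (\<Sum>i<dim_row A. \<Sum>j<dim_col A. cmod (A $$ (i, j)))"

definition frobenius_norm :: "complex mat \<Rightarrow> real" where
  "frobenius_norm A = sqrt (\<Sum>i<dim_row A. \<Sum>j<dim_col A. (cmod (A $$ (i, j)))\<^sup>2)"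

text \<open>
  Meant for nonzero square matrices; on a zero matrix the value is \<open>0 / 0 = 0\<close>.
\<close>

definition fourier_ratio :: "complex mat \<Rightarrow> real" where
  "fourier_ratio A =
     (let F = fourier_mat (dim_row A)
      in entrywise_l1_norm (F * A * F) / frobenius_norm (F * A * F))"

definition adjacency_mat :: "nat \<Rightarrow> complex mat \<Rightarrow> bool" where
  "adjacency_mat N A \<longleftrightarrow>
     A \<in> carrier_mat N N \<and>
     (\<forall>i<N. \<forall>j<N. A $$ (i, j) \<in> {0, 1}) \<and>
     transpose_mat A = A \<and>
     (\<forall>i<N. A $$ (i, i) = 0)"

definition graphs_fourier_ratio_le :: "nat \<Rightarrow> real \<Rightarrow> complex mat set" where
  "graphs_fourier_ratio_le N r =
     {A. adjacency_mat N A \<and> (\<exists>i<N. \<exists>j<N. A $$ (i, j) = 1) \<and> fourier_ratio A \<le> r}"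

end

theory Submission
  imports Defs "HOL-Analysis.Complex_Transcendental"
begin

text \<open>
  The complete graph has adjacency matrix \<open>J - I\<close>, and both \<open>F J F\<close> and \<open>F I F\<close> have
  \<open>\<ell>\<^sup>1\<close>-norm \<open>N\<close>. Deleting \<open>k\<close> edges subtracts a matrix \<open>P\<close> with \<open>2 k\<close> nonzero entries, and
  Cauchy--Schwarz with Parseval's identity bounds the \<open>\<ell>\<^sup>1\<close>-norm of \<open>F P F\<close> by \<open>N\<close> times
  \<open>sqrt (2 k)\<close>. As long as \<open>k\<close> is at most \<open>N\<^sup>2 / 16\<close>, the Frobenius norm stays at least
  \<open>N / 2\<close>, so the Fourier ratio is at most \<open>4 + 2 sqrt (2 k)\<close>. Hence every choice of
  \<open>k \<approx> r\<^sup>2 / 16\<close> deleted edges is admissible, and there are at least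
  \<open>((N choose 2) / k)\<^sup>k\<close> of these.
\<close>

section \<open>The discrete Fourier transform\<close>

text \<open>The indices range over all naturals, so that \<open>m + n\<close> can serve as a
  frequency without reduction modulo \<open>N\<close>.\<close>

definition fourier_coeff :: "nat \<Rightarrow> nat \<Rightarrow> nat \<Rightarrow> complex" where
  "fourier_coeff N m x = 1 / complex_of_real (sqrt (real N)) *
     exp (- 2 * complex_of_real pi * \<i> * of_nat m * of_nat x / of_nat N)"

definition dft :: "nat \<Rightarrow> (nat \<Rightarrow> complex) \<Rightarrow> nat \<Rightarrow> complex" where
  "dft N v m = (\<Sum>x<N. fourier_coeff N m x * v x)"

text \<open>For \<open>m, n < N\<close> this is an entry of \<open>F A F\<close>: by the symmetry of
  \<open>F\<close>, the right factor transforms the second variable just as the left factor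
  transforms the first.\<close>

definition dft2 :: "nat \<Rightarrow> (nat \<Rightarrow> nat \<Rightarrow> complex) \<Rightarrow> nat \<Rightarrow> nat \<Rightarrow> complex" where
  "dft2 N a m n = dft N (\<lambda>y. dft N (\<lambda>x. a x y) m) n"

lemma fourier_coeff_commute: "fourier_coeff N m x = fourier_coeff N x m"
  by (simp add: fourier_coeff_def mult_ac)

text \<open>A geometric sum whose ratio \<open>w\<close> satisfies \<open>w ^ N = 1\<close>, so it
  vanishes unless \<open>w = 1\<close>. The frequency is an integer because differences and
  negatives of indices occur.\<close>

lemma sum_roots_of_unity:
  fixes j :: int
  assumes "N > 0"
  shows "(\<Sum>x<N. exp (2 * complex_of_real pi * \<i> * of_int j * of_nat x / of_nat N)) =
    (if int N dvd j then of_nat N else 0)"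
proof -
  define w where "w = exp (2 * complex_of_real pi * \<i> * of_int j / of_nat N)"
  have pow: "exp (2 * complex_of_real pi * \<i> * of_int j * of_nat x / of_nat N) = w ^ x" for x
    by (simp add: w_def mult_ac flip: exp_of_nat_mult)
  have "w ^ N = exp (2 * complex_of_real pi * \<i> * of_int j)"
    using assms by (simp add: w_def flip: exp_of_nat_mult)
  then have wN: "w ^ N = 1"
    by (simp add: exp_eq_1)
  have w1: "w = 1 \<longleftrightarrow> int N dvd j"
  proof -
    have "w = 1 \<longleftrightarrow> (\<exists>n::int. 2 * pi * of_int j / real N = of_int (2 * n) * pi)"
      by (simp add: w_def exp_eq_1)
    also have "\<dots> \<longleftrightarrow> (\<exists>n::int. real_of_int j = real_of_int (int N * n))"
      using assms by (simp add: field_simps)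
    also have "\<dots> \<longleftrightarrow> int N dvd j"
      by (simp only: of_int_eq_iff dvd_def)
    finally show ?thesis .
  qed
  show ?thesis
    using w1 wN by (cases "w = 1") (simp_all add: pow sum_gp_strict)
qed

lemma fourier_coeff_orthogonal:
  assumes "x < N" "y < N"
  shows "(\<Sum>m<N. fourier_coeff N m x * cnj (fourier_coeff N m y)) = (if x = y then 1 else 0)"
proof -
  have N: "N > 0"
    using assms by simp
  have "fourier_coeff N m x * cnj (fourier_coeff N m y) =
      exp (2 * complex_of_real pi * \<i> * of_int (int y - int x) * of_nat m / of_nat N) / of_nat N" for m
  proof -
    have sq: "complex_of_real (sqrt (real N)) * complex_of_real (sqrt (real N)) = of_nat N"
      by (simp flip: of_real_mult)
    have "fourier_coeff N m x * cnj (fourier_coeff N m y) =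
        exp (- 2 * complex_of_real pi * \<i> * of_nat m * of_nat x / of_nat N) *
        exp (2 * complex_of_real pi * \<i> * of_nat m * of_nat y / of_nat N) / of_nat N"
      by (simp add: fourier_coeff_def exp_cnj flip: sq)
    also have "\<dots> =
        exp (2 * complex_of_real pi * \<i> * of_int (int y - int x) * of_nat m / of_nat N) / of_nat N"
      unfolding exp_add[symmetric]
      by (intro arg_cong2[where f = "(/)"] arg_cong[where f = exp] refl)
        (simp add: right_diff_distrib left_diff_distrib diff_divide_distrib mult_ac)
    finally show ?thesis .
  qed
  then have "(\<Sum>m<N. fourier_coeff N m x * cnj (fourier_coeff N m y)) =
      (if int N dvd int y - int x then of_nat N else 0) / of_nat N"
    using sum_roots_of_unity[OF N, of "int y - int x"] by (simp flip: sum_divide_distrib)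
  \<comment> \<open>Since \<open>x\<close> and \<open>y\<close> are both below \<open>N\<close>,
    their difference is divisible by \<open>N\<close> just when it is zero.\<close>
  moreover have "int N dvd int y - int x \<longleftrightarrow> x = y"
    using assms zdvd_imp_le[of "int N" "int y - int x"] zdvd_imp_le[of "int N" "int x - int y"]
    by (cases x y rule: linorder_cases) (auto simp: dvd_diff_commute[of "int N" "int y"])
  ultimately show ?thesis
    using N by simp
qed

text \<open>Expanding the squares and moving the sum over \<open>m\<close> innermost exposes the
  orthogonality relation, which leaves the terms with \<open>x = y\<close>.\<close>

lemma dft_parseval: "(\<Sum>m<N. (cmod (dft N v m))\<^sup>2) = (\<Sum>x<N. (cmod (v x))\<^sup>2)"
proof -
  have "complex_of_real (\<Sum>m<N. (cmod (dft N v m))\<^sup>2) =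
      (\<Sum>m<N. \<Sum>x<N. \<Sum>y<N. v x * cnj (v y) * (fourier_coeff N m x * cnj (fourier_coeff N m y)))"
    by (simp add: complex_norm_square dft_def cnj_sum sum_product mult_ac del: of_real_power)
  also have "\<dots> = (\<Sum>x<N. \<Sum>m<N. \<Sum>y<N.
      v x * cnj (v y) * (fourier_coeff N m x * cnj (fourier_coeff N m y)))"
    by (rule sum.swap)
  also have "\<dots> = (\<Sum>x<N. \<Sum>y<N. \<Sum>m<N.
      v x * cnj (v y) * (fourier_coeff N m x * cnj (fourier_coeff N m y)))"
    by (intro sum.cong refl sum.swap)
  also have "\<dots> = (\<Sum>x<N. \<Sum>y<N. v x * cnj (v y) * (if x = y then 1 else 0))"
    by (simp add: fourier_coeff_orthogonal flip: sum_distrib_left)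
  also have "\<dots> = (\<Sum>x<N. v x * cnj (v x))"
    by (intro sum.cong refl) (simp add: if_distrib sum.delta' cong: if_cong)
  also have "\<dots> = complex_of_real (\<Sum>x<N. (cmod (v x))\<^sup>2)"
    by (simp add: complex_norm_square del: of_real_power)
  finally show ?thesis
    by (simp only: of_real_eq_iff)
qed

lemma dft2_parseval:
  "(\<Sum>m<N. \<Sum>n<N. (cmod (dft2 N a m n))\<^sup>2) = (\<Sum>x<N. \<Sum>y<N. (cmod (a x y))\<^sup>2)"
proof -
  have "(\<Sum>m<N. \<Sum>n<N. (cmod (dft2 N a m n))\<^sup>2) =
      (\<Sum>m<N. \<Sum>y<N. (cmod (dft N (\<lambda>x. a x y) m))\<^sup>2)"
    by (simp add: dft2_def dft_parseval)
  also have "\<dots> = (\<Sum>y<N. \<Sum>m<N. (cmod (dft N (\<lambda>x. a x y) m))\<^sup>2)"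
    by (rule sum.swap)
  also have "\<dots> = (\<Sum>y<N. \<Sum>x<N. (cmod (a x y))\<^sup>2)"
    by (simp add: dft_parseval)
  also have "\<dots> = (\<Sum>x<N. \<Sum>y<N. (cmod (a x y))\<^sup>2)"
    by (rule sum.swap)
  finally show ?thesis .
qed

lemma dft_diff: "dft N (\<lambda>x. u x - v x) m = dft N u m - dft N v m"
  by (simp add: dft_def right_diff_distrib sum_subtractf)

lemma dft2_diff: "dft2 N (\<lambda>x y. a x y - b x y) m n = dft2 N a m n - dft2 N b m n"
  by (simp add: dft2_def dft_diff)

lemma fourier_conjugate_index:
  assumes "A \<in> carrier_mat N N" "m < N" "n < N"
  shows "(fourier_mat N * A * fourier_mat N) $$ (m, n) = dft2 N (\<lambda>x y. A $$ (x, y)) m n"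
proof -
  have F: "fourier_mat N = Matrix.mat N N (\<lambda>(m, x). fourier_coeff N m x)"
    by (simp add: fourier_mat_def fourier_coeff_def)
  show ?thesis
    using assms
    by (simp add: F dft2_def dft_def scalar_prod_def lessThan_atLeast0
        fourier_coeff_commute[of N n] mult.commute)
qed

lemma frobenius_norm_fourier_conjugate:
  assumes "A \<in> carrier_mat N N"
  shows "frobenius_norm (fourier_mat N * A * fourier_mat N) =
    sqrt (\<Sum>i<N. \<Sum>j<N. (cmod (A $$ (i, j)))\<^sup>2)"
proof -
  have "dim_row (fourier_mat N * A * fourier_mat N) = N" "dim_col (fourier_mat N * A * fourier_mat N) = N"
    by (simp_all add: fourier_mat_def)
  then show ?thesis
    unfolding frobenius_norm_def dft2_parseval[symmetric, where a = "\<lambda>i j. A $$ (i, j)"]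
    by (intro arg_cong[where f = sqrt] sum.cong)
      (simp_all only: fourier_conjugate_index[OF assms] lessThan_iff)
qed

text \<open>Cauchy--Schwarz over the \<open>N * N\<close> frequency pairs, then Parseval. This is
  efficient for sparse \<open>a\<close>; for the all-ones and identity matrices it would give
  \<open>N\<^sup>2\<close> and \<open>N * sqrt N\<close>, so their transforms are computed
  explicitly instead.\<close>

lemma l1_dft2_le: "(\<Sum>m<N. \<Sum>n<N. cmod (dft2 N a m n)) \<le> real N * sqrt (\<Sum>x<N. \<Sum>y<N. (cmod (a x y))\<^sup>2)"
proof -
  have "(\<Sum>m<N. \<Sum>n<N. cmod (dft2 N a m n))\<^sup>2 =
      (\<Sum>p\<in>{..<N}\<times>{..<N}. 1 * cmod (dft2 N a (fst p) (snd p)))\<^sup>2"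
    by (simp add: sum.cartesian_product case_prod_beta)
  also have "\<dots> \<le> (\<Sum>p\<in>{..<N}\<times>{..<N}. 1\<^sup>2) * (\<Sum>p\<in>{..<N}\<times>{..<N}. (cmod (dft2 N a (fst p) (snd p)))\<^sup>2)"
    by (rule Cauchy_Schwarz_ineq_sum)
  also have "\<dots> = (real N)\<^sup>2 * (\<Sum>m<N. \<Sum>n<N. (cmod (dft2 N a m n))\<^sup>2)"
    by (simp add: sum.cartesian_product case_prod_beta power2_eq_square)
  also have "\<dots> = (real N * sqrt (\<Sum>x<N. \<Sum>y<N. (cmod (a x y))\<^sup>2))\<^sup>2"
    by (simp add: dft2_parseval power_mult_distrib sum_nonneg)
  finally show ?thesis
    by (rule power2_le_imp_le) (simp add: sum_nonneg)
qed

lemma sum_fourier_coeff: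
  assumes "N > 0"
  shows "(\<Sum>x<N. fourier_coeff N m x) = (if N dvd m then complex_of_real (sqrt (real N)) else 0)"
proof -
  have e: "exp (- 2 * complex_of_real pi * \<i> * of_nat m * of_nat x / of_nat N) =
      exp (2 * complex_of_real pi * \<i> * of_int (- int m) * of_nat x / of_nat N)" for x
    by simp
  have "(\<Sum>x<N. fourier_coeff N m x) =
      1 / complex_of_real (sqrt (real N)) * (if int N dvd - int m then of_nat N else 0)"
    unfolding fourier_coeff_def e sum_distrib_left[symmetric] sum_roots_of_unity[OF assms] ..
  moreover have "of_nat N / complex_of_real (sqrt (real N)) = complex_of_real (sqrt (real N))"
    by (metis of_real_divide of_real_of_nat_eq real_div_sqrt of_nat_0_le_iff)
  ultimately show ?thesis
    by simp
qed

text \<open>The transform of the all-ones matrix is concentrated at frequency \<open>(0, 0)\<close>,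
  where it equals \<open>N\<close>.\<close>

lemma l1_dft2_const: "(\<Sum>m<N. \<Sum>n<N. cmod (dft2 N (\<lambda>x y. 1) m n)) \<le> real N"
proof (cases "N = 0")
  case False
  have "cmod (dft2 N (\<lambda>x y. 1) m n) = (if m = 0 then if n = 0 then real N else 0 else 0)"
    if "m < N" "n < N" for m n
  proof -
    have "N dvd m \<longleftrightarrow> m = 0" "N dvd n \<longleftrightarrow> n = 0"
      using that by (auto dest: dvd_imp_le)
    then show ?thesis
      using False
      by (simp add: dft2_def dft_def sum_fourier_coeff norm_mult flip: sum_distrib_right)
  qed
  then have "(\<Sum>m<N. \<Sum>n<N. cmod (dft2 N (\<lambda>x y. 1) m n)) =
      (\<Sum>m<N. \<Sum>n<N. if m = 0 then if n = 0 then real N else 0 else 0)"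
    by (intro sum.cong refl) simp
  also have "\<dots> = (\<Sum>m<N. if m = 0 then real N else 0)"
    using False by (intro sum.cong refl) simp
  also have "\<dots> = real N"
    using False by simp
  finally show ?thesis
    by simp
qed simp

text \<open>The transform of the identity is \<open>F * F\<close>, the permutation matrix of
  negation modulo \<open>N\<close>, so each row contributes at most 1.\<close>

lemma l1_dft2_identity: "(\<Sum>m<N. \<Sum>n<N. cmod (dft2 N (\<lambda>x y. if x = y then 1 else 0) m n)) \<le> real N"
proof (cases "N = 0")
  case False
  have entry: "cmod (dft2 N (\<lambda>x y. if x = y then 1 else 0) m n) = (if N dvd m + n then 1 else 0)" for m n
  proof -
    have prod: "fourier_coeff N n y * fourier_coeff N m y =
        1 / complex_of_real (sqrt (real N)) * fourier_coeff N (m + n) y" for y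
      by (simp add: fourier_coeff_def algebra_simps add_divide_distrib diff_divide_distrib flip: exp_add)
    have "dft2 N (\<lambda>x y. if x = y then 1 else 0) m n = (\<Sum>y<N. fourier_coeff N n y * fourier_coeff N m y)"
      unfolding dft2_def dft_def
      by (intro sum.cong refl) (simp add: if_distrib cong: if_cong)
    also have "\<dots> = 1 / complex_of_real (sqrt (real N)) * (\<Sum>y<N. fourier_coeff N (m + n) y)"
      by (simp only: prod sum_distrib_left)
    finally show ?thesis
      using False by (simp add: sum_fourier_coeff)
  qed
  have "(\<Sum>n<N. cmod (dft2 N (\<lambda>x y. if x = y then 1 else 0) m n)) \<le> 1" for m
  proof -
    have "n = n'" if "n < N" "n' < N" "N dvd m + n" "N dvd m + n'" for n n'
    proof -
      \<comment> \<open>Both truncated differences are multiples of \<open>N\<close> below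
        \<open>N\<close>, hence zero.\<close>
      have "N dvd n - n'" "N dvd n' - n"
        using dvd_diff_nat[OF that(3,4)] dvd_diff_nat[OF that(4,3)] by simp_all
      then show ?thesis
        using that(1,2) nat_dvd_not_less[of "n - n'" N] nat_dvd_not_less[of "n' - n" N] by linarith
    qed
    then have "card ({..<N} \<inter> {n. N dvd m + n}) \<le> 1"
      by (intro card_le_Suc0_iff_eq[THEN iffD2, unfolded One_nat_def[symmetric]]) auto
    then show ?thesis
      by (simp add: entry sum.If_cases)
  qed
  then have "(\<Sum>m<N. \<Sum>n<N. cmod (dft2 N (\<lambda>x y. if x = y then 1 else 0) m n)) \<le> (\<Sum>m<N. 1)"
    by (rule sum_mono)
  then show ?thesis
    by simp
qed simp

section \<open>Complete graphs with deleted edges\<close>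

text \<open>Edges are represented by pairs \<open>(i, j)\<close> with \<open>i < j\<close>.\<close>

definition vertex_pairs :: "nat \<Rightarrow> (nat \<times> nat) set" where
  "vertex_pairs N = {(i, j). i < j \<and> j < N}"

text \<open>Each edge is listed in one orientation; the union with the converse deletes both matrix
  entries and keeps the matrix symmetric.\<close>

definition complete_minus :: "nat \<Rightarrow> (nat \<times> nat) set \<Rightarrow> complex mat" where
  "complete_minus N E = Matrix.mat N N (\<lambda>(i, j). if i = j \<or> (i, j) \<in> E \<union> E\<inverse> then 0 else 1)"

lemma vertex_pairs_eq_Sigma: "vertex_pairs N = prod.swap ` (SIGMA j:{..<N}. {..<j})"
  by (force simp: vertex_pairs_def)

lemma finite_vertex_pairs: "finite (vertex_pairs N)"
  by (simp add: vertex_pairs_eq_Sigma)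

lemma card_vertex_pairs: "2 * card (vertex_pairs N) = N * (N - 1)"
proof -
  have "card (vertex_pairs N) = (\<Sum>j<N. j)"
    by (simp add: vertex_pairs_eq_Sigma card_image)
  then show ?thesis
    using Sum_Ico_nat[of 0 N] by (cases N) (simp_all add: lessThan_atLeast0)
qed

text \<open>The deleted edges can be read off as the zeros strictly above the diagonal.\<close>

lemma inj_on_complete_minus: "inj_on (complete_minus N) (Pow (vertex_pairs N))"
proof (rule inj_on_inverseI)
  fix E assume "E \<in> Pow (vertex_pairs N)"
  then show "{(i, j). i < j \<and> j < N \<and> complete_minus N E $$ (i, j) = 0} = E"
    by (auto simp: complete_minus_def vertex_pairs_def split: if_splits)
qed

lemma adjacency_complete_minus: "adjacency_mat N (complete_minus N E)"
  by (auto simp: adjacency_mat_def complete_minus_def)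

text \<open>A 0/1 matrix is determined by the positions of its ones. Finiteness matters for the
  count because \<open>card\<close> of an infinite set is 0.\<close>

lemma finite_adjacency_mats: "finite {A. adjacency_mat N A}"
proof (rule finite_subset)
  let ?f = "\<lambda>S. Matrix.mat N N (\<lambda>p. if p \<in> S then 1 else 0 :: complex)"
  show "{A. adjacency_mat N A} \<subseteq> ?f ` Pow ({..<N} \<times> {..<N})"
  proof
    fix A assume "A \<in> {A. adjacency_mat N A}"
    then have "A = ?f {(i, j). i < N \<and> j < N \<and> A $$ (i, j) = 1}"
      by (intro eq_matI) (auto simp: adjacency_mat_def)
    then show "A \<in> ?f ` Pow ({..<N} \<times> {..<N})"
      by (rule image_eqI) auto
  qed
qed simp

text \<open>The entries are 0 or 1, so the sum counts the ones; the zeros are the \<open>N\<close>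
  diagonal positions and at most two positions per deleted edge.\<close>

lemma sum_norm_complete_minus:
  assumes "E \<subseteq> vertex_pairs N"
  shows "(\<Sum>i<N. \<Sum>j<N. (cmod (complete_minus N E $$ (i, j)))\<^sup>2) \<ge> (real N)\<^sup>2 - real N - 2 * real (card E)"
proof -
  let ?D = "(\<lambda>i. (i, i)) ` {..<N}" and ?S = "{..<N} \<times> {..<N}"
  have fin: "finite E"
    using assms finite_vertex_pairs by (rule finite_subset)
  have "card (?D \<union> (E \<union> E\<inverse>)) \<le> card ?D + (card E + card (E\<inverse>))"
    by (meson card_Un_le add_left_mono le_trans)
  also have "\<dots> \<le> N + 2 * card E"
    using card_image_le[of "{..<N}" "\<lambda>i. (i, i)"] by (simp add: card_inverse)
  finally have "card (?D \<union> (E \<union> E\<inverse>)) \<le> N + 2 * card E" .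
  moreover have "card ?S - card (?D \<union> (E \<union> E\<inverse>)) \<le> card (?S - (?D \<union> (E \<union> E\<inverse>)))"
    using fin by (intro diff_card_le_card_Diff) auto
  ultimately have "N * N \<le> card (?S - (?D \<union> (E \<union> E\<inverse>))) + (N + 2 * card E)"
    by simp
  then have "real (N * N) \<le> real (card (?S - (?D \<union> (E \<union> E\<inverse>))) + (N + 2 * card E))"
    by (simp only: of_nat_le_iff)
  moreover have "(\<Sum>i<N. \<Sum>j<N. (cmod (complete_minus N E $$ (i, j)))\<^sup>2) =
      (\<Sum>p\<in>?S. if p \<in> ?D \<union> (E \<union> E\<inverse>) then 0 else 1)"
    unfolding sum.cartesian_product
    by (intro sum.cong refl) (auto simp: complete_minus_def image_iff split: if_splits)
  moreover have "\<dots> = real (card (?S - (?D \<union> (E \<union> E\<inverse>))))"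
    by (simp add: sum.If_cases del: Un_iff) (simp add: Diff_eq)
  ultimately show ?thesis
    by (simp add: power2_eq_square)
qed

lemma l1_fourier_complete_minus:
  assumes "E \<subseteq> vertex_pairs N"
  shows "entrywise_l1_norm (fourier_mat N * complete_minus N E * fourier_mat N) \<le>
    2 * real N + real N * sqrt (2 * real (card E))"
proof -
  let ?J = "\<lambda>x y. 1 :: complex" and ?I = "\<lambda>x y. if x = y then 1 else 0 :: complex"
    and ?P = "\<lambda>x y. if (x, y) \<in> E \<union> E\<inverse> then 1 else 0 :: complex"
  have fin: "finite E"
    using assms finite_vertex_pairs by (rule finite_subset)
  have A: "complete_minus N E \<in> carrier_mat N N"
    by (simp add: complete_minus_def)
  have dims: "dim_row (fourier_mat N * complete_minus N E * fourier_mat N) = N"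
      "dim_col (fourier_mat N * complete_minus N E * fourier_mat N) = N"
    by (simp_all add: fourier_mat_def)
  \<comment> \<open>As \<open>i < j\<close> on \<open>E\<close>, the supports of \<open>?I\<close>
    and \<open>?P\<close> are disjoint, and no entry is subtracted twice.\<close>
  have "complete_minus N E $$ (x, y) = ?J x y - ?I x y - ?P x y" if "x < N" "y < N" for x y
    using that assms by (auto simp: complete_minus_def vertex_pairs_def)
  then have "dft2 N (\<lambda>x y. complete_minus N E $$ (x, y)) m n =
      dft2 N (\<lambda>x y. ?J x y - ?I x y - ?P x y) m n" for m n
    unfolding dft2_def dft_def by (intro sum.cong refl arg_cong2[where f = "(*)"]) simp_all
  then have "cmod (dft2 N (\<lambda>x y. complete_minus N E $$ (x, y)) m n) \<le>
      cmod (dft2 N ?J m n) + cmod (dft2 N ?I m n) + cmod (dft2 N ?P m n)" for m n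
    unfolding dft2_diff by (simp only: order_trans[OF norm_triangle_ineq4 add_right_mono[OF norm_triangle_ineq4]])
  then have "entrywise_l1_norm (fourier_mat N * complete_minus N E * fourier_mat N) \<le>
      (\<Sum>m<N. \<Sum>n<N. cmod (dft2 N ?J m n) + cmod (dft2 N ?I m n) + cmod (dft2 N ?P m n))"
    unfolding entrywise_l1_norm_def dims
    by (intro sum_mono) (simp only: fourier_conjugate_index[OF A] lessThan_iff)
  also have "\<dots> \<le> real N + real N + real N * sqrt (\<Sum>x<N. \<Sum>y<N. (cmod (?P x y))\<^sup>2)"
    unfolding sum.distrib
    by (intro add_mono l1_dft2_const l1_dft2_identity l1_dft2_le)
  also have "(\<Sum>x<N. \<Sum>y<N. (cmod (?P x y))\<^sup>2) = (\<Sum>p\<in>{..<N}\<times>{..<N}. if p \<in> E \<union> E\<inverse> then 1 else 0)"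
    unfolding sum.cartesian_product by (intro sum.cong refl) (auto split: if_splits)
  also have "\<dots> = real (card (({..<N}\<times>{..<N}) \<inter> (E \<union> E\<inverse>)))"
    by (simp add: sum.If_cases del: Un_iff)
  also have "\<dots> \<le> real (2 * card E)"
  proof (rule of_nat_mono)
    have "card (({..<N}\<times>{..<N}) \<inter> (E \<union> E\<inverse>)) \<le> card (E \<union> E\<inverse>)"
      using fin by (intro card_mono) auto
    also have "\<dots> \<le> 2 * card E"
      using card_Un_le[of E "E\<inverse>"] by (simp add: card_inverse)
    finally show "card (({..<N}\<times>{..<N}) \<inter> (E \<union> E\<inverse>)) \<le> 2 * card E" .
  qed
  finally show ?thesis
    by (simp add: mult_left_mono)
qed

lemma complete_minus_in_graphs:
  assumes E: "E \<subseteq> vertex_pairs N" and N: "N \<ge> 2" and "card E \<le> r\<^sup>2 / 16" "r \<le> N" and r: "r \<ge> 16"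
  shows "complete_minus N E \<in> graphs_fourier_ratio_le N r"
proof -
  let ?A = "complete_minus N E" and ?F = "fourier_mat N"
  let ?S = "\<Sum>i<N. \<Sum>j<N. (cmod (?A $$ (i, j)))\<^sup>2"
  have A: "?A \<in> carrier_mat N N"
    by (simp add: complete_minus_def)
  have "r\<^sup>2 \<le> (real N)\<^sup>2"
    using assms by (intro power_mono) auto
  moreover have "2 * real N \<le> (real N)\<^sup>2"
    using N by (simp add: power2_eq_square)
  \<comment> \<open>From \<open>N\<^sup>2\<close> one loses \<open>N\<close>, at most
    \<open>N\<^sup>2 / 2\<close>, and \<open>2 * card E\<close>, at most
    \<open>N\<^sup>2 / 8\<close>; what remains exceeds \<open>N\<^sup>2 / 4\<close>.\<close>
  ultimately have S: "?S \<ge> (real N / 2)\<^sup>2"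
    using sum_norm_complete_minus[OF E] assms(3) by (simp add: power_divide)
  have "\<exists>i<N. \<exists>j<N. ?A $$ (i, j) \<noteq> 0"
  proof (rule ccontr)
    assume "\<not> ?thesis"
    then have "?S = 0"
      by simp
    then show False
      using S N by simp
  qed
  then have edge: "\<exists>i<N. \<exists>j<N. ?A $$ (i, j) = 1"
    using adjacency_complete_minus[of N E] unfolding adjacency_mat_def by blast
  \<comment> \<open>The radicand is at most \<open>r\<^sup>2 / 8\<close>, and \<open>3 / 8\<close>
    is a rational upper bound for \<open>sqrt (1 / 8)\<close>. The gap \<open>r / 8\<close> between
    this bound and \<open>r / 2\<close> absorbs the summand 2 because
    \<open>r \<ge> 16\<close>.\<close>
  have "sqrt (2 * real (card E)) \<le> sqrt ((3 / 8 * r)\<^sup>2)"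
    using assms(3) by (intro real_sqrt_le_mono) (simp add: power_mult_distrib power_divide)
  then have "sqrt (2 * real (card E)) \<le> 3 / 8 * r"
    using r by simp
  then have "2 * real N + real N * sqrt (2 * real (card E)) \<le> real N * (r / 2)"
    using r mult_left_mono[of "2 + sqrt (2 * real (card E))" "r / 2" "real N"]
    by (simp add: algebra_simps)
  also have "\<dots> \<le> r * sqrt ?S"
    using r real_le_rsqrt[OF S] mult_left_mono[of "real N / 2" "sqrt ?S" r] by (simp add: mult_ac)
  finally have "entrywise_l1_norm (?F * ?A * ?F) \<le> r * frobenius_norm (?F * ?A * ?F)"
    using l1_fourier_complete_minus[OF E] unfolding frobenius_norm_fourier_conjugate[OF A] by linarith
  moreover have "frobenius_norm (?F * ?A * ?F) > 0"
    using real_le_rsqrt[OF S] N unfolding frobenius_norm_fourier_conjugate[OF A]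
    by (smt (verit) half_gt_zero_iff of_nat_0_less_iff less_le_trans zero_less_numeral)
  ultimately have "fourier_ratio ?A \<le> r"
    using A by (simp add: fourier_ratio_def Let_def divide_le_eq)
  then show ?thesis
    using edge adjacency_complete_minus by (simp add: graphs_fourier_ratio_le_def)
qed

section \<open>Counting\<close>

text \<open>Distinct \<open>k\<close>-sets of deleted edges give distinct admissible graphs.\<close>

lemma card_graphs_ge_binomial:
  assumes "N \<ge> 2" "real k \<le> r\<^sup>2 / 16" "r \<le> N" "r \<ge> 16"
  shows "card (vertex_pairs N) choose k \<le> card (graphs_fourier_ratio_le N r)"
proof -
  let ?K = "{E. E \<subseteq> vertex_pairs N \<and> card E = k}"
  have "card (vertex_pairs N) choose k = card ?K"
    by (simp add: n_subsets finite_vertex_pairs)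
  also have "\<dots> = card (complete_minus N ` ?K)"
    by (intro card_image[symmetric] inj_on_subset[OF inj_on_complete_minus]) auto
  also have "\<dots> \<le> card (graphs_fourier_ratio_le N r)"
  proof (rule card_mono)
    show "finite (graphs_fourier_ratio_le N r)"
      by (rule finite_subset[OF _ finite_adjacency_mats[of N]]) (auto simp: graphs_fourier_ratio_le_def)
    show "complete_minus N ` ?K \<subseteq> graphs_fourier_ratio_le N r"
      using complete_minus_in_graphs assms by auto
  qed
  finally show ?thesis .
qed

lemma card_graphs_lower_bound:
  assumes N: "N \<ge> 2" and rN: "r \<le> real N" and r: "r \<ge> 16"
  shows "2 powr (1 / 16 * r\<^sup>2 * ln (real N / r)) \<le> real (card (graphs_fourier_ratio_le N r))"
proof -
  \<comment> \<open>The largest number of deletions that the Fourier ratio bound permits. Rounding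
    down costs less than 1, so \<open>k\<close> keeps at least half of
    \<open>r\<^sup>2 / 16\<close>.\<close>
  define k where "k = nat \<lfloor>r\<^sup>2 / 16\<rfloor>"
  define M where "M = card (vertex_pairs N)"
  have "16 * 16 \<le> r * r"
    using r by (intro mult_mono) auto
  then have r2: "r\<^sup>2 \<ge> 256"
    by (simp add: power2_eq_square)
  have k_le: "real k \<le> r\<^sup>2 / 16" and k_ge: "real k \<ge> r\<^sup>2 / 32"
    using r2 unfolding k_def by linarith+
  have "real (2 * M) = real N * (real N - 1)"
    using N unfolding M_def card_vertex_pairs by (simp add: of_nat_diff)
  moreover have "real N * real N \<ge> 2 * real N"
    using N by (intro mult_right_mono) auto
  ultimately have M: "real M \<ge> (real N)\<^sup>2 / 4"
    by (simp add: power2_eq_square algebra_simps)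
  have "r\<^sup>2 \<le> (real N)\<^sup>2"
    using rN r by (intro power_mono) auto
  then have "real k \<le> real M"
    using k_le M by linarith
  then have kM: "k \<le> M"
    by simp
  have k0: "real k > 0"
    using k_ge r2 by linarith
  have ratio: "real N / r \<ge> 1"
    using rN r by simp
  \<comment> \<open>Here \<open>M\<close> is at least \<open>N\<^sup>2 / 4\<close> and
    \<open>k\<close> at most \<open>r\<^sup>2 / 16\<close>, which leaves a spare factor 4.\<close>
  have "(real N / r)\<^sup>2 \<le> real M / real k"
  proof -
    have "(real N)\<^sup>2 * real k \<le> (real N)\<^sup>2 * (r\<^sup>2 / 16)"
      using k_le by (rule mult_left_mono) simp
    also have "\<dots> \<le> (real N)\<^sup>2 / 4 * r\<^sup>2"
      by simp
    also have "\<dots> \<le> real M * r\<^sup>2"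
      using M by (rule mult_right_mono) simp
    finally show ?thesis
      using k0 r by (simp add: power_divide field_simps)
  qed
  \<comment> \<open>The exponent is nonnegative because \<open>r \<le> N\<close>, so the base 2 may
    be raised to \<open>exp 1\<close>, matching the natural logarithm.\<close>
  have "2 powr (1 / 16 * r\<^sup>2 * ln (real N / r)) \<le> exp 1 powr (1 / 16 * r\<^sup>2 * ln (real N / r))"
    using ratio exp_ge_add_one_self[of 1] by (intro powr_mono2) auto
  also have "\<dots> = exp (r\<^sup>2 / 16 * ln (real N / r))"
    by (simp add: powr_def)
  \<comment> \<open>The constant \<open>1 / 16\<close> arises here: \<open>2 * k\<close> is at least
    \<open>r\<^sup>2 / 16\<close>, and the factor 2 becomes the square of
    \<open>N / r\<close>.\<close>
  also have "\<dots> \<le> exp (real (2 * k) * ln (real N / r))"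
    using k_ge ratio by (intro iffD2[OF exp_le_cancel_iff] mult_right_mono) auto
  also have "\<dots> = ((real N / r)\<^sup>2) ^ k"
    using ratio by (simp only: exp_of_nat_mult power_mult) simp
  also have "\<dots> \<le> (real M / real k) ^ k"
    using \<open>(real N / r)\<^sup>2 \<le> real M / real k\<close> by (rule power_mono) simp
  also have "\<dots> \<le> real (M choose k)"
    using binomial_ge_n_over_k_pow_k[OF kM, where 'a = real] by simp
  also have "\<dots> \<le> real (card (graphs_fourier_ratio_le N r))"
    using card_graphs_ge_binomial[OF N k_le rN r] by (simp add: M_def)
  finally show ?thesis .
qed

theorem theorem4p8:
  shows "\<exists>c::real. c > 0 \<and>
    (\<forall>r :: nat \<Rightarrow> real.
       filterlim r at_top sequentially \<longrightarrow>
       (\<lambda>N. r N / real N) \<longlonglongrightarrow> 0 \<longrightarrow>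
       (\<forall>\<^sub>F N in sequentially.
          real (card (graphs_fourier_ratio_le N (r N)))
            \<ge> 2 powr (c * (r N)\<^sup>2 * ln (real N / r N))))"
proof (intro exI[of _ "1 / 16"] conjI allI impI)
  fix r :: "nat \<Rightarrow> real"
  assume "filterlim r at_top sequentially"
  then have "\<forall>\<^sub>F N in sequentially. 16 \<le> r N"
    by (simp add: filterlim_at_top)
  moreover assume "(\<lambda>N. r N / real N) \<longlonglongrightarrow> 0"
  \<comment> \<open>The limit 0 enters through the eventual bound \<open>r N < N\<close>, which
    supplies the hypothesis \<open>r \<le> N\<close> of the fixed-\<open>N\<close> estimate.\<close>
  then have "\<forall>\<^sub>F N in sequentially. r N / real N < 1"
    by (rule order_tendstoD) simp
  moreover have "\<forall>\<^sub>F N in sequentially. N \<ge> (2::nat)"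
    by (rule eventually_ge_at_top)
  ultimately show "\<forall>\<^sub>F N in sequentially. 2 powr (1 / 16 * (r N)\<^sup>2 * ln (real N / r N)) \<le>
      real (card (graphs_fourier_ratio_le N (r N)))"
    by eventually_elim (intro card_graphs_lower_bound; simp add: divide_less_eq)
qed simp

end
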